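(* Let $\mathcal M$ be a nonempty finite workflow pool and $1\le k\le K_{\max}$. If $\psi_k$ is nondecreasing, then $I_k(\mathcal M)=\mathrm{OPT}_k(\mathcal M)$. Consequently (when $\psi_k$ is nondecreasing for every $k=1,\dots,K_{\max}$), $$\mathrm{OPT}_{\psi,\gamma}(\mathcal M)=\max\Big\{0,\max_{1\le k\le K_{\max}}I_k(\mathcal M)\Big\}.$$
   Context: Setting. There are $n\ge1$ development tasks $i=1,\dots,n$ and workflow types $g\in\mathcal M$, with correctness indicators $a_{ig}\in\{0,1\}$, execution costs $c_g\ge0$, cost price $\gamma\ge0$, and an integer $K_{\max}\ge1$. For $\boldsymbol m\in\mathbb Z_+^{\mathcal M}$ put $k(\boldsymbol m)=\sum_g m_g$, $r_i(\boldsymbol m)=\sum_g a_{ig}m_g$, $C(\boldsymbol m)=\sum_g c_gm_g$. Recovery curves are functions $\psi_k:\{0,\dots,k\}\to[0,1]$, $k=1,\dots,K_{\max}$, with $\psi_k(0)=0$, $\psi_k(k)=1$; $d_{\ell,k}=\psi_k(\ell)-\psi_k(\ell-1)$ for $\ell=1,\dots,k$. For $\boldsymbol m\neq\boldsymbol 0$ with $k(\boldsymbol m)\le K_{\max}$, $\Pi_{\psi,\gamma}(\boldsymbol m)=\frac1n\sum_{i=1}^n\psi_{k(\boldsymbol m)}(r_i(\boldsymbol m))-\gamma C(\boldsymbol m)$, and $\Pi_{\psi,\gamma}(\boldsymbol 0)=0$. $\mathrm{OPT}_k(\mathcal M)=\max\{\Pi_{\psi,\gamma}(\boldsymbol m):\boldsymbol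 m\in\mathbb Z_+^{\mathcal M},\,k(\boldsymbol m)=k\}$ and $\mathrm{OPT}_{\psi,\gamma}(\mathcal M)=\max\{\Pi_{\psi,\gamma}(\boldsymbol m):\boldsymbol m\in\mathbb Z_+^{\mathcal M},\,k(\boldsymbol m)\le K_{\max}\}$. $I_k(\mathcal M)$ is the optimal value of the integer program: maximize $$\frac1n\sum_{i=1}^n\sum_{\ell=1}^k d_{\ell,k}\,y_{i\ell}-\gamma\sum_{g\in\mathcal M}c_gz_g$$ subject to $\sum_{\ell=1}^k y_{i\ell}\le\sum_{g\in\mathcal M}a_{ig}z_g$ for all $i$; $y_{i\ell}\le y_{i,\ell-1}$ for all $i$ and $\ell=2,\dots,k$; $\sum_{g\in\mathcal M}z_g=k$; $z_g\in\mathbb Z_+$ for $g\in\mathcal M$; $y_{i\ell}\in\{0,1\}$ for all $i,\ell$. *)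

theory Defs
  imports Complex_Main "HOL-Library.FuncSet"
begin

text \<open>Tasks are indexed by \<open>{1..n}\<close>. A vector in \<open>\<int>\<^sub>+\<^sup>M\<close> is an extensional function
  \<open>m \<in> M \<rightarrow>\<^sub>E (UNIV :: nat set)\<close>, so that each vector has a unique representation and the
  feasible sets below are finite.\<close>

definition workflow_count :: "'g set \<Rightarrow> ('g \<Rightarrow> nat) \<Rightarrow> nat" where
  "workflow_count M m = (\<Sum>g\<in>M. m g)"

definition correct_count :: "'g set \<Rightarrow> (nat \<Rightarrow> 'g \<Rightarrow> nat) \<Rightarrow> nat \<Rightarrow> ('g \<Rightarrow> nat) \<Rightarrow> nat" where
  "correct_count M a i m = (\<Sum>g\<in>M. a i g * m g)"

definition total_cost :: "'g set \<Rightarrow> ('g \<Rightarrow> real) \<Rightarrow> ('g \<Rightarrow> nat) \<Rightarrow> real" where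
  "total_cost M c m = (\<Sum>g\<in>M. c g * real (m g))"

definition recovery_curve :: "nat \<Rightarrow> (nat \<Rightarrow> real) \<Rightarrow> bool" where
  "recovery_curve k \<phi> \<longleftrightarrow> (\<forall>l\<in>{0..k}. 0 \<le> \<phi> l \<and> \<phi> l \<le> 1) \<and> \<phi> 0 = 0 \<and> \<phi> k = 1"

text \<open>Only used for \<open>1 \<le> l\<close>, where \<open>l - 1\<close> is genuine subtraction.\<close>

definition increment :: "(nat \<Rightarrow> nat \<Rightarrow> real) \<Rightarrow> nat \<Rightarrow> nat \<Rightarrow> real" where
  "increment \<psi> l k = \<psi> k l - \<psi> k (l - 1)"

definition profit ::
  "nat \<Rightarrow> 'g set \<Rightarrow> (nat \<Rightarrow> 'g \<Rightarrow> nat) \<Rightarrow> ('g \<Rightarrow> real) \<Rightarrow> real \<Rightarrow> (nat \<Rightarrow> nat \<Rightarrow> real)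
    \<Rightarrow> ('g \<Rightarrow> nat) \<Rightarrow> real" where
  "profit n M a c \<gamma> \<psi> m =
    (if \<forall>g\<in>M. m g = 0 then 0
     else (1 / real n) * (\<Sum>i=1..n. \<psi> (workflow_count M m) (correct_count M a i m))
            - \<gamma> * total_cost M c m)"

definition OPT_size ::
  "nat \<Rightarrow> 'g set \<Rightarrow> (nat \<Rightarrow> 'g \<Rightarrow> nat) \<Rightarrow> ('g \<Rightarrow> real) \<Rightarrow> real \<Rightarrow> (nat \<Rightarrow> nat \<Rightarrow> real)
    \<Rightarrow> nat \<Rightarrow> real" where
  "OPT_size n M a c \<gamma> \<psi> k =
    Max (profit n M a c \<gamma> \<psi> ` {m \<in> M \<rightarrow>\<^sub>E UNIV. workflow_count M m = k})"

definition OPT ::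
  "nat \<Rightarrow> 'g set \<Rightarrow> (nat \<Rightarrow> 'g \<Rightarrow> nat) \<Rightarrow> ('g \<Rightarrow> real) \<Rightarrow> real \<Rightarrow> (nat \<Rightarrow> nat \<Rightarrow> real)
    \<Rightarrow> nat \<Rightarrow> real" where
  "OPT n M a c \<gamma> \<psi> Kmax =
    Max (profit n M a c \<gamma> \<psi> ` {m \<in> M \<rightarrow>\<^sub>E UNIV. workflow_count M m \<le> Kmax})"

definition IP_feasible ::
  "nat \<Rightarrow> 'g set \<Rightarrow> (nat \<Rightarrow> 'g \<Rightarrow> nat) \<Rightarrow> nat \<Rightarrow> ((nat \<Rightarrow> nat \<Rightarrow> nat) \<times> ('g \<Rightarrow> nat)) set" where
  "IP_feasible n M a k =
    {(y, z). y \<in> {1..n} \<rightarrow>\<^sub>E ({1..k} \<rightarrow>\<^sub>E {0, 1}) \<and> z \<in> M \<rightarrow>\<^sub>E UNIV \<and>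
      (\<forall>i\<in>{1..n}. (\<Sum>l=1..k. y i l) \<le> (\<Sum>g\<in>M. a i g * z g)) \<and>
      (\<forall>i\<in>{1..n}. \<forall>l\<in>{2..k}. y i l \<le> y i (l - 1)) \<and>
      (\<Sum>g\<in>M. z g) = k}"

definition IP_objective ::
  "nat \<Rightarrow> 'g set \<Rightarrow> ('g \<Rightarrow> real) \<Rightarrow> real \<Rightarrow> (nat \<Rightarrow> nat \<Rightarrow> real) \<Rightarrow> nat
    \<Rightarrow> (nat \<Rightarrow> nat \<Rightarrow> nat) \<times> ('g \<Rightarrow> nat) \<Rightarrow> real" where
  "IP_objective n M c \<gamma> \<psi> k =
    (\<lambda>(y, z). (1 / real n) * (\<Sum>i=1..n. \<Sum>l=1..k. increment \<psi> l k * real (y i l))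
       - \<gamma> * (\<Sum>g\<in>M. c g * real (z g)))"

definition IP_value ::
  "nat \<Rightarrow> 'g set \<Rightarrow> (nat \<Rightarrow> 'g \<Rightarrow> nat) \<Rightarrow> ('g \<Rightarrow> real) \<Rightarrow> real \<Rightarrow> (nat \<Rightarrow> nat \<Rightarrow> real)
    \<Rightarrow> nat \<Rightarrow> real" where
  "IP_value n M a c \<gamma> \<psi> k = Max (IP_objective n M c \<gamma> \<psi> k ` IP_feasible n M a k)"

text \<open>For finite nonempty \<open>M\<close> the sets maximized over are finite and nonempty, so each \<^const>\<open>Max\<close> above is an
  attained maximum.\<close>

lemma finite_vectors_le:
  assumes "finite M"
  shows "finite {m \<in> M \<rightarrow>\<^sub>E (UNIV :: nat set). workflow_count M m \<le> k}"
proof (rule finite_subset)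
  show "{m \<in> M \<rightarrow>\<^sub>E UNIV. workflow_count M m \<le> k} \<subseteq> M \<rightarrow>\<^sub>E {..k}"
  proof
    fix m assume m: "m \<in> {m \<in> M \<rightarrow>\<^sub>E UNIV. workflow_count M m \<le> k}"
    have "m g \<le> k" if "g \<in> M" for g
      using m member_le_sum[OF that, of m] assms by (auto simp: workflow_count_def)
    with m show "m \<in> M \<rightarrow>\<^sub>E {..k}" by (auto simp: PiE_iff)
  qed
  show "finite (M \<rightarrow>\<^sub>E {..k})" using assms by (simp add: finite_PiE)
qed

lemma finite_vectors_eq:
  assumes "finite M"
  shows "finite {m \<in> M \<rightarrow>\<^sub>E (UNIV :: nat set). workflow_count M m = k}"
  by (rule finite_subset[OF _ finite_vectors_le[OF assms, of k]]) auto

lemma vectors_eq_nonempty: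
  assumes "finite M" and "M \<noteq> {}"
  shows "{m \<in> M \<rightarrow>\<^sub>E (UNIV :: nat set). workflow_count M m = k} \<noteq> {}"
proof -
  obtain h where h: "h \<in> M" using assms(2) by blast
  have "restrict (\<lambda>g. if g = h then k else 0) M
      \<in> {m \<in> M \<rightarrow>\<^sub>E UNIV. workflow_count M m = k}"
    using assms(1) h by (simp add: workflow_count_def)
  then show ?thesis by blast
qed

lemma vectors_le_nonempty:
  "{m \<in> M \<rightarrow>\<^sub>E (UNIV :: nat set). workflow_count M m \<le> k} \<noteq> {}"
proof -
  have "restrict (\<lambda>_. 0) M \<in> {m \<in> M \<rightarrow>\<^sub>E UNIV. workflow_count M m \<le> k}"
    by (simp add: workflow_count_def)
  then show ?thesis by blast
qed

lemma finite_IP_feasible: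
  assumes "finite M"
  shows "finite (IP_feasible n M a k)"
proof (rule finite_subset)
  show "IP_feasible n M a k \<subseteq> ({1..n} \<rightarrow>\<^sub>E ({1..k} \<rightarrow>\<^sub>E {0, 1}))
      \<times> {m \<in> M \<rightarrow>\<^sub>E UNIV. workflow_count M m = k}"
    by (auto simp: IP_feasible_def workflow_count_def)
  show "finite (({1..n} \<rightarrow>\<^sub>E ({1..k} \<rightarrow>\<^sub>E {0, 1 :: nat}))
      \<times> {m \<in> M \<rightarrow>\<^sub>E (UNIV :: nat set). workflow_count M m = k})"
    by (intro finite_cartesian_product finite_PiE finite_vectors_eq assms) auto
qed

lemma IP_feasible_nonempty:
  assumes "finite M" and "M \<noteq> {}"
  shows "IP_feasible n M a k \<noteq> {}"
proof -
  obtain z where z: "z \<in> M \<rightarrow>\<^sub>E (UNIV :: nat set)" "(\<Sum>g\<in>M. z g) = k"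
    using vectors_eq_nonempty[OF assms, of k] by (auto simp: workflow_count_def)
  have "(restrict (\<lambda>_. restrict (\<lambda>_. 0) {1..k}) {1..n}, z) \<in> IP_feasible n M a k"
    using z by (auto simp: IP_feasible_def)
  then show ?thesis by blast
qed

end

theory Submission
  imports Defs
begin

text \<open>For a task \<open>i\<close> the chain constraints force the binary string \<open>y i\<close> to be the indicator of an
  initial segment \<open>{1..s}\<close>, and then the increments telescope to \<open>\<psi> k s\<close>. The coupling constraint says
  that \<open>s\<close> is at most the number \<open>r\<close> of correct attempts, so for nondecreasing \<open>\<psi> k\<close> the best choice
  is \<open>s = r\<close>, which reproduces the profit of \<open>z\<close>.\<close>

text \<open>Induction on \<open>k\<close>, split by the last bit. A last bit 0 leaves the sum
  unchanged; a last bit 1 propagates down the chain, so all bits are 1 and the sum is the full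
  length.\<close>

lemma antimono_binary_eq_initial_segment:
  fixes b :: "nat \<Rightarrow> nat"
  assumes "\<And>l. l \<in> {1..k} \<Longrightarrow> b l \<in> {0, 1}"
    and "\<And>l. l \<in> {2..k} \<Longrightarrow> b l \<le> b (l - 1)"
    and "l \<in> {1..k}"
  shows "b l = of_bool (l \<le> (\<Sum>j=1..k. b j))"
  using assms
proof (induction k arbitrary: l)
  case 0
  then show ?case by simp
next
  case (Suc k)
  let ?s = "\<Sum>j=1..k. b j"
  have IH: "b j = of_bool (j \<le> ?s)" if "j \<in> {1..k}" for j
    using Suc.IH[of j] Suc.prems(1,2) that by simp
  \<comment> \<open>This bound makes the indicator at \<open>Suc k\<close> vanish when the last bit
    is 0.\<close>
  have "?s \<le> (\<Sum>j=1..k. 1)"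
    using Suc.prems(1) by (intro sum_mono) fastforce
  then have s_le: "?s \<le> k" by simp
  consider "b (Suc k) = 0" | "b (Suc k) = 1"
    using Suc.prems(1)[of "Suc k"] by auto
  then show ?case
  proof cases
    case 1
    then show ?thesis
      using IH[of l] s_le Suc.prems(3) by (cases "l = Suc k") auto
  next
    case 2
    have "?s = k"
    \<comment> \<open>For positive \<open>k\<close> the chain gives \<open>b k = 1\<close>, and the
      induction hypothesis at \<open>k\<close> then says \<open>k \<le> ?s\<close>. For
      \<open>k = 0\<close> the sum is empty.\<close>
    proof (cases "k = 0")
      case False
      then have "b k \<ge> 1" using Suc.prems(2)[of "Suc k"] 2 by simp
      then have "k \<le> ?s" using IH[of k] False by (cases "k \<le> ?s") auto
      with s_le show ?thesis by simp
    qed simp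
    then show ?thesis
      using IH[of l] 2 Suc.prems(3) by (cases "l = Suc k") auto
  qed
qed

lemma sum_of_bool_le:
  fixes r k :: nat
  assumes "r \<le> k"
  shows "(\<Sum>l=1..k. of_bool (l \<le> r)) = r"
proof -
  have "{1..k} \<inter> {l. l \<le> r} = {1..r}" using assms by auto
  then show ?thesis by (simp add: sum.If_cases of_bool_def)
qed

lemma sum_increment_initial_segment:
  assumes "r \<le> k"
  shows "(\<Sum>l=1..k. increment \<psi> l k * of_bool (l \<le> r)) = \<psi> k r - \<psi> k 0"
proof -
  have "(\<Sum>l=1..k. increment \<psi> l k * of_bool (l \<le> r)) = (\<Sum>l=1..r. increment \<psi> l k)"
    using assms by (intro sum.mono_neutral_cong_right) auto
  also have "\<dots> = \<psi> k r - \<psi> k 0"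
    unfolding increment_def by (induction r) auto
  finally show ?thesis .
qed

text \<open>Keeps each correct count in \<open>{0..k}\<close>, where \<open>\<psi> k\<close> is
  monotone, and guarantees that \<open>k\<close> bits suffice to encode it.\<close>

lemma correct_count_le_workflow_count:
  assumes "\<And>g. g \<in> M \<Longrightarrow> a i g \<le> 1"
  shows "correct_count M a i m \<le> workflow_count M m"
  unfolding correct_count_def workflow_count_def
proof (rule sum_mono)
  fix g assume "g \<in> M"
  from mult_right_mono[OF assms[OF this], of "m g"] show "a i g * m g \<le> m g" by simp
qed

text \<open>A positive size excludes the zero vector, so the separate value 0 in
  \<open>profit\<close> does not apply.\<close>

lemma profit_of_size:
  assumes "workflow_count M m = k" "k \<ge> 1"
  shows "profit n M a c \<gamma> \<psi> m =
    (1 / real n) * (\<Sum>i=1..n. \<psi> k (correct_count M a i m)) - \<gamma> * total_cost M c m"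
proof -
  have "\<not> (\<forall>g\<in>M. m g = 0)"
    using assms sum.neutral[of M m] unfolding workflow_count_def by linarith
  then show ?thesis by (simp only: profit_def assms(1) if_False)
qed

text \<open>With \<open>z\<close> fixed the costs agree, so it suffices to bound the contribution of
  each task separately.\<close>

lemma IP_objective_le_profit:
  assumes a: "\<And>i g. i \<in> {1..n} \<Longrightarrow> g \<in> M \<Longrightarrow> a i g \<le> 1"
    and k: "k \<ge> 1" and \<psi>: "\<psi> k 0 = 0" "mono_on {0..k} (\<psi> k)"
    and feas: "(y, z) \<in> IP_feasible n M a k"
  shows "IP_objective n M c \<gamma> \<psi> k (y, z) \<le> profit n M a c \<gamma> \<psi> z"
proof -
  have size: "workflow_count M z = k"
    using feas by (simp add: IP_feasible_def workflow_count_def)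
  have "(\<Sum>l=1..k. increment \<psi> l k * real (y i l)) \<le> \<psi> k (correct_count M a i z)"
    if i: "i \<in> {1..n}" for i
  proof -
    let ?s = "\<Sum>l=1..k. y i l"
    have s: "?s \<le> correct_count M a i z"
      using feas i by (simp add: IP_feasible_def correct_count_def)
    have r: "correct_count M a i z \<le> k"
      using correct_count_le_workflow_count[of M a i z] a[OF i] size by simp
    have bin: "y i l \<in> {0, 1}" if "l \<in> {1..k}" for l
      using feas i that unfolding IP_feasible_def by (blast dest: PiE_mem)
    have chain: "y i l \<le> y i (l - 1)" if "l \<in> {2..k}" for l
      using feas i that by (simp add: IP_feasible_def)
    have "(\<Sum>l=1..k. increment \<psi> l k * real (y i l))
        = (\<Sum>l=1..k. increment \<psi> l k * of_bool (l \<le> ?s))"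
    proof (rule sum.cong[OF refl])
      fix l assume "l \<in> {1..k}"
      from antimono_binary_eq_initial_segment[of k "y i", OF bin chain this]
      show "increment \<psi> l k * real (y i l) = increment \<psi> l k * of_bool (l \<le> ?s)"
        by simp
    qed
    also have "\<dots> = \<psi> k ?s"
      using sum_increment_initial_segment[of ?s k \<psi>] s r \<psi>(1) by simp
    \<comment> \<open>Monotonicity enters here: the coupling constraint orders the two arguments,
      and both lie in \<open>{0..k}\<close>.\<close>
    also have "\<dots> \<le> \<psi> k (correct_count M a i z)"
      using s r by (intro mono_onD[OF \<psi>(2)]) auto
    finally show ?thesis .
  qed
  then have "(1 / real n) * (\<Sum>i=1..n. \<Sum>l=1..k. increment \<psi> l k * real (y i l))
      \<le> (1 / real n) * (\<Sum>i=1..n. \<psi> k (correct_count M a i z))"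
    by (intro mult_left_mono sum_mono) auto
  then show ?thesis
    by (simp add: profit_of_size[OF size k] IP_objective_def total_cost_def)
qed

text \<open>Setting exactly as many leading bits as there are correct attempts makes the coupling
  constraint tight, so nothing is lost in the telescoped sum.\<close>

lemma profit_attained_by_IP:
  assumes a: "\<And>i g. i \<in> {1..n} \<Longrightarrow> g \<in> M \<Longrightarrow> a i g \<le> 1"
    and k: "k \<ge> 1" and \<psi>: "\<psi> k 0 = 0"
    and m: "m \<in> M \<rightarrow>\<^sub>E UNIV" "workflow_count M m = k"
  obtains y where "(y, m) \<in> IP_feasible n M a k"
    and "IP_objective n M c \<gamma> \<psi> k (y, m) = profit n M a c \<gamma> \<psi> m"
proof
  \<comment> \<open>Both uses of \<open>restrict\<close> serve to place \<open>y\<close> in the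
    extensional function spaces of \<open>IP_feasible\<close>.\<close>
  define y :: "nat \<Rightarrow> nat \<Rightarrow> nat" where
    "y = restrict (\<lambda>i. restrict (\<lambda>l. of_bool (l \<le> correct_count M a i m)) {1..k}) {1..n}"
  have y: "y i l = of_bool (l \<le> correct_count M a i m)" if "i \<in> {1..n}" "l \<in> {1..k}" for i l
    using that by (simp add: y_def)
  have r: "correct_count M a i m \<le> k" if "i \<in> {1..n}" for i
    using correct_count_le_workflow_count[of M a i m] a[OF that] m(2) by simp
  have "(\<Sum>l=1..k. y i l) = correct_count M a i m" if i: "i \<in> {1..n}" for i
    using sum_of_bool_le[OF r[OF i]] y[OF i] by simp
  moreover have "y \<in> {1..n} \<rightarrow>\<^sub>E ({1..k} \<rightarrow>\<^sub>E {0, 1})"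
    by (auto simp: y_def)
  moreover have "y i l \<le> y i (l - 1)" if "i \<in> {1..n}" "l \<in> {2..k}" for i l
  proof -
    \<comment> \<open>Since \<open>l\<close> is at least 2, \<open>y\<close> is given by the
      indicator at both indices, and the indicator is antitone.\<close>
    have "l \<in> {1..k}" "l - 1 \<in> {1..k}" using that(2) by auto
    then show ?thesis by (auto simp: y[OF that(1)])
  qed
  ultimately show "(y, m) \<in> IP_feasible n M a k"
    using m by (simp add: IP_feasible_def correct_count_def workflow_count_def)
  have "(\<Sum>l=1..k. increment \<psi> l k * real (y i l)) = \<psi> k (correct_count M a i m)"
    if i: "i \<in> {1..n}" for i
    using sum_increment_initial_segment[OF r[OF i], of \<psi>] y[OF i] \<psi> by simp
  then show "IP_objective n M c \<gamma> \<psi> k (y, m) = profit n M a c \<gamma> \<psi> m"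
    by (simp add: profit_of_size[OF m(2) k] IP_objective_def total_cost_def)
qed

lemma IP_value_eq_OPT_size:
  assumes M: "finite M" "M \<noteq> {}"
    and a: "\<And>i g. i \<in> {1..n} \<Longrightarrow> g \<in> M \<Longrightarrow> a i g \<le> 1"
    and k: "k \<ge> 1" and \<psi>: "\<psi> k 0 = 0" "mono_on {0..k} (\<psi> k)"
  shows "IP_value n M a c \<gamma> \<psi> k = OPT_size n M a c \<gamma> \<psi> k"
proof (rule antisym)
  let ?V = "{m \<in> M \<rightarrow>\<^sub>E UNIV. workflow_count M m = k}"
  note fin = finite_vectors_eq[OF M(1), of k] finite_IP_feasible[OF M(1), of n a k]
  note ne = vectors_eq_nonempty[OF M, of k] IP_feasible_nonempty[OF M, of n a k]
  show "IP_value n M a c \<gamma> \<psi> k \<le> OPT_size n M a c \<gamma> \<psi> k"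
    unfolding IP_value_def
  proof (rule Max.boundedI)
    fix v assume "v \<in> IP_objective n M c \<gamma> \<psi> k ` IP_feasible n M a k"
    then obtain y z where yz: "(y, z) \<in> IP_feasible n M a k"
      and v: "v = IP_objective n M c \<gamma> \<psi> k (y, z)" by auto
    have "v \<le> profit n M a c \<gamma> \<psi> z"
      unfolding v using a k \<psi> yz by (rule IP_objective_le_profit)
    \<comment> \<open>The size constraint of the program makes \<open>z\<close> itself a candidate
      for \<open>OPT_size\<close>.\<close>
    also have "\<dots> \<le> OPT_size n M a c \<gamma> \<psi> k"
      unfolding OPT_size_def using fin yz
      by (intro Max_ge) (auto simp: IP_feasible_def workflow_count_def)
    finally show "v \<le> OPT_size n M a c \<gamma> \<psi> k" .
  qed (use fin ne in auto)
  show "OPT_size n M a c \<gamma> \<psi> k \<le> IP_value n M a c \<gamma> \<psi> k"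
    unfolding OPT_size_def
  proof (rule Max.boundedI)
    fix v assume "v \<in> profit n M a c \<gamma> \<psi> ` ?V"
    then obtain m where m: "m \<in> M \<rightarrow>\<^sub>E UNIV" "workflow_count M m = k"
      and v: "v = profit n M a c \<gamma> \<psi> m" by auto
    obtain y where y: "(y, m) \<in> IP_feasible n M a k"
      and eq: "IP_objective n M c \<gamma> \<psi> k (y, m) = profit n M a c \<gamma> \<psi> m"
      using profit_attained_by_IP[of n M a k \<psi> m c \<gamma>] a k \<psi>(1) m by blast
    show "v \<le> IP_value n M a c \<gamma> \<psi> k"
      unfolding IP_value_def v eq[symmetric] using fin y by (intro Max_ge) auto
  qed (use fin ne in auto)
qed

text \<open>Vectors are sorted by size: size 0 contributes the value 0, and each size
  \<open>k\<close> from 1 to \<open>Kmax\<close> contributes \<open>OPT_size\<close> at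
  \<open>k\<close>.\<close>

lemma OPT_eq_max_OPT_size:
  assumes M: "finite M" "M \<noteq> {}" and "Kmax \<ge> 1"
  shows "OPT n M a c \<gamma> \<psi> Kmax = max 0 (Max (OPT_size n M a c \<gamma> \<psi> ` {1..Kmax}))"
    (is "_ = max 0 ?R")
proof (rule antisym)
  let ?W = "{m \<in> M \<rightarrow>\<^sub>E UNIV. workflow_count M m \<le> Kmax}"
  note fin = finite_vectors_le[OF M(1), of Kmax]
  show "OPT n M a c \<gamma> \<psi> Kmax \<le> max 0 ?R"
    unfolding OPT_def
  proof (rule Max.boundedI)
    fix v assume "v \<in> profit n M a c \<gamma> \<psi> ` ?W"
    then obtain m where m: "m \<in> M \<rightarrow>\<^sub>E UNIV" "workflow_count M m \<le> Kmax"
      and v: "v = profit n M a c \<gamma> \<psi> m" by auto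
    show "v \<le> max 0 ?R"
    proof (cases "workflow_count M m = 0")
      case True
      \<comment> \<open>Over a finite \<open>M\<close>, a zero sum of naturals forces every entry to
        vanish.\<close>
      then have "v = 0"
        using M(1) by (simp add: v profit_def workflow_count_def)
      then show ?thesis by simp
    next
      case False
      have "v \<le> OPT_size n M a c \<gamma> \<psi> (workflow_count M m)"
        unfolding OPT_size_def v using m finite_vectors_eq[OF M(1)] by (intro Max_ge) auto
      also have "\<dots> \<le> ?R"
        using False m(2) by (intro Max_ge) auto
      finally show ?thesis by simp
    qed
  qed (use fin vectors_le_nonempty[of M Kmax] in auto)
  have "0 \<le> OPT n M a c \<gamma> \<psi> Kmax"
    unfolding OPT_def
  proof (rule Max_ge)
    show "0 \<in> profit n M a c \<gamma> \<psi> ` ?W"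
      \<comment> \<open>The witness is the zero vector, in extensional form.\<close>
      by (rule image_eqI[of _ _ "restrict (\<lambda>_. 0) M"]) (auto simp: profit_def workflow_count_def)
  qed (use fin in simp)
  moreover have "?R \<le> OPT n M a c \<gamma> \<psi> Kmax"
  proof (rule Max.boundedI)
    fix v assume "v \<in> OPT_size n M a c \<gamma> \<psi> ` {1..Kmax}"
    then obtain k where "k \<le> Kmax" "v = OPT_size n M a c \<gamma> \<psi> k" by auto
    \<comment> \<open>Vectors of size \<open>k\<close> form a nonempty subset of those of size at
      most \<open>Kmax\<close>, so the maxima compare.\<close>
    then show "v \<le> OPT n M a c \<gamma> \<psi> Kmax"
      unfolding OPT_def OPT_size_def using fin vectors_eq_nonempty[OF M, of k]
      by (auto intro!: Max_mono)
  qed (use assms(3) in auto)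
  ultimately show "max 0 ?R \<le> OPT n M a c \<gamma> \<psi> Kmax" by simp
qed

theorem proposition2:
  fixes n Kmax :: nat
    and M :: "'g set"
    and a :: "nat \<Rightarrow> 'g \<Rightarrow> nat"
    and c :: "'g \<Rightarrow> real"
    and \<gamma> :: real
    and \<psi> :: "nat \<Rightarrow> nat \<Rightarrow> real"
  assumes "n \<ge> 1"
    and "Kmax \<ge> 1"
    and "finite M"
    and "M \<noteq> {}"
    and "\<And>i g. i \<in> {1..n} \<Longrightarrow> g \<in> M \<Longrightarrow> a i g \<in> {0, 1}"
    and "\<And>g. g \<in> M \<Longrightarrow> c g \<ge> 0"
    and "\<gamma> \<ge> 0"
    and "\<And>k. k \<in> {1..Kmax} \<Longrightarrow> recovery_curve k (\<psi> k)"
  shows "(\<forall>k\<in>{1..Kmax}. mono_on {0..k} (\<psi> k)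
            \<longrightarrow> IP_value n M a c \<gamma> \<psi> k = OPT_size n M a c \<gamma> \<psi> k)
       \<and> ((\<forall>k\<in>{1..Kmax}. mono_on {0..k} (\<psi> k))
            \<longrightarrow> OPT n M a c \<gamma> \<psi> Kmax = max 0 (Max (IP_value n M a c \<gamma> \<psi> ` {1..Kmax})))"
proof -
  have a: "a i g \<le> 1" if "i \<in> {1..n}" "g \<in> M" for i g
    using assms(5)[OF that] by auto
  have eq: "IP_value n M a c \<gamma> \<psi> k = OPT_size n M a c \<gamma> \<psi> k"
    if "k \<in> {1..Kmax}" "mono_on {0..k} (\<psi> k)" for k
    using assms(3,4) a
  proof (rule IP_value_eq_OPT_size)
    show "\<psi> k 0 = 0" using assms(8)[OF that(1)] by (simp add: recovery_curve_def)
  qed (use that in auto)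
  \<comment> \<open>Monotonicity at every size lets the two families be exchanged under
    \<open>Max\<close>.\<close>
  have "IP_value n M a c \<gamma> \<psi> ` {1..Kmax} = OPT_size n M a c \<gamma> \<psi> ` {1..Kmax}"
    if "\<forall>k\<in>{1..Kmax}. mono_on {0..k} (\<psi> k)"
    using eq that by (intro image_cong) auto
  with eq OPT_eq_max_OPT_size[OF assms(3,4,2)] show ?thesis by simp
qed

end
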